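(* Let $\mathbb{F}=\mathbb{R}$, let $N\ge2$, $M\ge2$ and $Q$ be integers with $1\le Q\le M-1$, write $\mathcal{M}=\{1,\dots,M\}$, let $0<\epsilon<1$, and let $\mathbf{H}_1,\dots,\mathbf{H}_M$ be $N\times N$ real symmetric positive semidefinite matrices. Let $v^{\min}_{\rm QP}$ be the optimal value of (P1): minimize $\|\mathbf{w}\|^2$ over $\mathbf{w}\in\mathbb{R}^N$, $\boldsymbol\beta\in\{0,1\}^M$ subject to $\mathbf{w}^T\mathbf{H}_i\mathbf{w}\ge\beta_i+(1-\beta_i)\epsilon$ ($i\in\mathcal{M}$) and $\sum_{i}\beta_i=Q$; and let $v^{\min}_{\rm SDP2}$ be the optimal value of (SDP2): minimize $\mathrm{Tr}[\mathbf{X}]$ over real symmetric $N\times N$ matrices $\mathbf{X}\succeq0$ and $\boldsymbol\beta\in\mathbb{R}^M$ subject to $\mathrm{Tr}[\mathbf{H}_i\mathbf{X}]\ge\beta_i+(1-\beta_i)\epsilon$ ($i\in\mathcal{M}$), $\sum_i\beta_i=Q$, $0\le\beta_i\le1$. Then $$v^{\min}_{\rm QP}\le\bar\mu_{\mathbb{R}}\,v^{\min}_{\rm SDP2},\qquad \bar\mu_{\mathbb{R}}=\max\left\{\frac{27\Big[M-Q+\sqrt{\tfrac{1}{c(\epsilon)}}\,Q\Big]^2}{\pi},\ \frac{12(\sqrt{2M}-1)^2}{(\pi-2)^2c(\epsilon)}\right\},$$ where $c(\epsilon)=\epsilon+\frac{1-\epsilon}{M-Q+1}$. *)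

theory Defs
  imports "HOL-Analysis.Analysis"
begin

definition psd_sym :: "real^'n^'n \<Rightarrow> bool" where
  "psd_sym A \<longleftrightarrow> transpose A = A \<and> (\<forall>x. 0 \<le> x \<bullet> (A *v x))"

text \<open>Optimal value of (P1); infeasible problem has value +infinity.\<close>
definition v_QP :: "nat \<Rightarrow> nat \<Rightarrow> real \<Rightarrow> (nat \<Rightarrow> real^'n^'n) \<Rightarrow> ereal" where
  "v_QP M Q \<epsilon> H = Inf {ereal ((norm w)\<^sup>2) | w \<beta>.
      (\<forall>i\<in>{1..M}. \<beta> i \<in> {0, 1}) \<and>
      (\<forall>i\<in>{1..M}. w \<bullet> (H i *v w) \<ge> \<beta> i + (1 - \<beta> i) * \<epsilon>) \<and>
      (\<Sum>i\<in>{1..M}. \<beta> i) = real Q}"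

text \<open>Optimal value of (SDP2); infeasible problem has value +infinity.\<close>
definition v_SDP2 :: "nat \<Rightarrow> nat \<Rightarrow> real \<Rightarrow> (nat \<Rightarrow> real^'n^'n) \<Rightarrow> ereal" where
  "v_SDP2 M Q \<epsilon> H = Inf {ereal (trace X) | X \<beta>.
      psd_sym X \<and>
      (\<forall>i\<in>{1..M}. trace (H i ** X) \<ge> \<beta> i + (1 - \<beta> i) * \<epsilon>) \<and>
      (\<Sum>i\<in>{1..M}. \<beta> i) = real Q \<and>
      (\<forall>i\<in>{1..M}. 0 \<le> \<beta> i \<and> \<beta> i \<le> 1)}"

definition c_eps :: "nat \<Rightarrow> nat \<Rightarrow> real \<Rightarrow> real" where
  "c_eps M Q \<epsilon> = \<epsilon> + (1 - \<epsilon>) / (real M - real Q + 1)"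

definition mu_R :: "nat \<Rightarrow> nat \<Rightarrow> real \<Rightarrow> real" where
  "mu_R M Q \<epsilon> = max
     (27 * (real M - real Q + sqrt (1 / c_eps M Q \<epsilon>) * real Q)\<^sup>2 / pi)
     (12 * (sqrt (2 * real M) - 1)\<^sup>2 / ((pi - 2)\<^sup>2 * c_eps M Q \<epsilon>))"

end

theory Submission
  imports Defs
begin

text \<open>
  The bound already holds with the constant \<open>(M - Q + Q / \<surd>c)\<^sup>2\<close>, where \<open>c\<close> is
  \<open>c_eps M Q \<epsilon>\<close>. Let \<open>(X, \<beta>)\<close> be feasible for (SDP2) with \<open>t = trace X\<close>. At least \<open>Q\<close> of
  the \<open>\<beta> i\<close> are at least \<open>1 / (M - Q + 1)\<close>, so that \<open>trace (H i ** X)\<close> is at least \<open>c\<close> for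
  \<open>Q\<close> indices and at least \<open>\<epsilon>\<close> for the others. Since the largest eigenvalue of \<open>H i\<close> is at
  least \<open>trace (H i ** X) / t\<close>, there is a unit vector \<open>u i\<close> with
  \<open>x \<bullet> (H i *v x) \<ge> (trace (H i ** X) / t) * (x \<bullet> u i)\<^sup>2\<close> for all \<open>x\<close>. The problem is thus
  reduced to finding a short \<open>x\<close> with \<open>\<bar>x \<bullet> u i\<bar> \<ge> w i\<close>, where \<open>w i\<close> is \<open>\<surd>(t / c)\<close> or \<open>\<surd>t\<close>.
  Bang's lemma on planks yields such an \<open>x\<close> of norm at most the sum of the \<open>w i\<close>.
\<close>

section \<open>Bang's lemma on planks\<close>

text \<open>Take a signed sum of the \<open>w i *\<^sub>R u i\<close> of maximal norm. Flipping the
  sign at one index cannot lengthen it, which forces its component along that \<open>u i\<close> to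
  be at least \<open>w i\<close> in absolute value. The triangle inequality bounds its norm.\<close>

lemma bang:
  fixes u :: "'i \<Rightarrow> 'a::real_inner" and w :: "'i \<Rightarrow> real"
  assumes "finite I" and unit: "\<And>i. i \<in> I \<Longrightarrow> norm (u i) = 1" and pos: "\<And>i. i \<in> I \<Longrightarrow> 0 < w i"
  shows "\<exists>x. norm x \<le> (\<Sum>i\<in>I. w i) \<and> (\<forall>i\<in>I. w i \<le> \<bar>x \<bullet> u i\<bar>)"
proof -
  define F where "F J = (\<Sum>i\<in>I. (if i \<in> J then w i else - w i) *\<^sub>R u i)" for J
  define m where "m = Max ((\<lambda>J. norm (F J)) ` Pow I)"
  have fin: "finite ((\<lambda>J. norm (F J)) ` Pow I)"
    using \<open>finite I\<close> by simp
  have "m \<in> (\<lambda>J. norm (F J)) ` Pow I"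
    unfolding m_def using fin by (intro Max_in) auto
  then obtain J where J: "J \<subseteq> I" "m = norm (F J)"
    by auto
  have max: "norm (F J') \<le> norm (F J)" if "J' \<subseteq> I" for J'
    using that fin J(2) unfolding m_def by (metis Max_ge Pow_iff image_eqI)
  have "w j \<le> \<bar>F J \<bullet> u j\<bar>" if j: "j \<in> I" for j
  proof -
    define s where "s = (if j \<in> J then w j else - w j)"
    \<comment> \<open>\<open>J\<close> is the set of indices with a plus sign, and \<open>J'\<close>
      flips the sign of \<open>j\<close> alone.\<close>
    define J' where "J' = (if j \<in> J then J - {j} else insert j J)"
    have J': "J' \<subseteq> I"
      using J j by (auto simp: J'_def)
    have rest: "(\<Sum>i\<in>I - {j}. (if i \<in> J' then w i else - w i) *\<^sub>R u i)
        = (\<Sum>i\<in>I - {j}. (if i \<in> J then w i else - w i) *\<^sub>R u i)"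
      by (rule sum.cong) (auto simp: J'_def)
    have "F J' = F J - (2 * s) *\<^sub>R u j"
      unfolding F_def sum.remove[OF \<open>finite I\<close> j] rest
      by (auto simp: s_def J'_def algebra_simps scaleR_2 simp flip: scaleR_add_left)
    with max[OF J'] have "(norm (F J - (2 * s) *\<^sub>R u j))\<^sup>2 \<le> (norm (F J))\<^sup>2"
      by (simp add: power_mono)
    moreover have "u j \<bullet> u j = 1"
      using unit[OF j] by (simp add: norm_eq_1)
    \<comment> \<open>Expanding the square turns the maximality into
      \<open>- 4 * s * (F J \<bullet> u j) + 4 * s\<^sup>2 \<le> 0\<close>.\<close>
    ultimately have "s * s \<le> s * (F J \<bullet> u j)"
      by (simp add: power2_norm_eq_inner inner_diff_left inner_diff_right inner_commute)
    also have "\<dots> \<le> \<bar>s\<bar> * \<bar>F J \<bullet> u j\<bar>"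
      by (metis abs_ge_self abs_mult)
    finally have "\<bar>s\<bar> * \<bar>s\<bar> \<le> \<bar>s\<bar> * \<bar>F J \<bullet> u j\<bar>"
      by simp
    moreover have "\<bar>s\<bar> = w j"
      using pos[OF j] by (simp add: s_def)
    ultimately show ?thesis
      using pos[OF j] by simp
  qed
  moreover have "norm (F J) \<le> (\<Sum>i\<in>I. w i)"
    unfolding F_def by (rule sum_norm_le) (auto simp: unit less_imp_le[OF pos])
  ultimately show ?thesis
    by blast
qed

section \<open>Semidefinite forms and traces of products\<close>

lemma psd_sym_inner_commute: "psd_sym A \<Longrightarrow> x \<bullet> (A *v y) = y \<bullet> (A *v x)"
  by (metis dot_lmul_matrix inner_commute psd_sym_def transpose_matrix_vector)

lemma psd_sym_Cauchy_Schwarz: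
  assumes "psd_sym A"
  shows "(x \<bullet> (A *v y))\<^sup>2 \<le> (x \<bullet> (A *v x)) * (y \<bullet> (A *v y))"
proof -
  define a b c where "a = x \<bullet> (A *v x)" and "b = x \<bullet> (A *v y)" and "c = y \<bullet> (A *v y)"
  \<comment> \<open>The form is expanded with two coefficients, so that the degenerate case
    \<open>a = 0\<close> can be read off as well.\<close>
  have q: "0 \<le> a * r\<^sup>2 - 2 * b * r * s + c * s\<^sup>2" for r s
  proof -
    have "0 \<le> (r *\<^sub>R x - s *\<^sub>R y) \<bullet> (A *v (r *\<^sub>R x - s *\<^sub>R y))"
      using assms by (simp add: psd_sym_def)
    also have "\<dots> = a * r\<^sup>2 - 2 * b * r * s + c * s\<^sup>2"
      using psd_sym_inner_commute[OF assms, of y x]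
      by (simp add: a_def b_def c_def matrix_vector_mult_diff_distrib matrix_vector_mult_scaleR
          inner_diff_left inner_diff_right algebra_simps power2_eq_square)
    finally show ?thesis .
  qed
  have "0 \<le> a"
    using assms by (simp add: a_def psd_sym_def)
  have "b\<^sup>2 \<le> a * c"
  proof (cases "a = 0")
    case True
    have "0 \<le> c"
      using assms by (simp add: c_def psd_sym_def)
    \<comment> \<open>With \<open>a = 0\<close> the form is linear in \<open>r\<close>; taking
      \<open>r = c + 1\<close> and \<open>s = b\<close> makes the negative term dominate.\<close>
    moreover have "0 \<le> - (c + 2) * b\<^sup>2"
      using q[of "c + 1" b] True by (simp add: algebra_simps power2_eq_square)
    ultimately have "b\<^sup>2 \<le> 0"
      by (simp add: zero_le_mult_iff)
    then show ?thesis
      using True by simp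
  next
    case False
    with \<open>0 \<le> a\<close> have "0 < a"
      by simp
    have "0 \<le> a * (a * c - b\<^sup>2)"
      using q[of b a] by (simp add: power2_eq_square algebra_simps)
    with \<open>0 < a\<close> show ?thesis
      by (simp add: zero_le_mult_iff)
  qed
  then show ?thesis
    by (simp add: a_def b_def c_def)
qed

lemma inner_axis_matrix: "axis i 1 \<bullet> (A *v axis j 1) = (A :: real^'n^'m) $ i $ j"
  by (simp add: inner_axis' matrix_vector_mult_basis column_def)

lemma trace_mult_eq_sum: "trace (A ** X) = (\<Sum>i\<in>UNIV. \<Sum>k\<in>UNIV. A $ i $ k * X $ k $ i)"
  by (simp add: trace_def matrix_matrix_mult_def)

text \<open>Each step of the induction is a Cholesky step: subtracting \<open>y y\<^sup>T / X $ k $ k\<close>, where \<open>y\<close>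
  is column \<open>k\<close> of \<open>X\<close>, keeps \<open>X\<close> positive semidefinite and clears row and column \<open>k\<close>.\<close>

lemma trace_mult_psd_nonneg:
  fixes A X :: "real^'n^'n"
  assumes A: "\<And>v. 0 \<le> v \<bullet> (A *v v)" and "psd_sym X"
  shows "0 \<le> trace (A ** X)"
  using \<open>psd_sym X\<close>
proof (induction "card {k. X $ k $ k \<noteq> 0}" arbitrary: X rule: less_induct)
  case less
  note CS = psd_sym_Cauchy_Schwarz[OF less.prems]
  have diag: "0 \<le> X $ i $ i" for i
    using less.prems inner_axis_matrix[of i X i] by (metis psd_sym_def)
  have zero: "X $ i $ j = 0" if "X $ i $ i = 0" for i j
    using CS[of "axis i 1" "axis j 1"] that by (simp add: inner_axis_matrix)
  show ?case
  proof (cases "\<forall>k. X $ k $ k = 0")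
    case True
    then show ?thesis
      using zero by (simp add: trace_mult_eq_sum)
  next
    case False
    then obtain k where "X $ k $ k \<noteq> 0"
      by blast
    with diag[of k] have k: "0 < X $ k $ k"
      by simp
    define y where "y = X *v axis k 1"
    define Y where "Y = (\<chi> i j. X $ i $ j - y $ i * y $ j / X $ k $ k)"
    have sym: "X $ i $ j = X $ j $ i" for i j
      using psd_sym_inner_commute[OF less.prems, of "axis i 1" "axis j 1"]
      by (simp add: inner_axis_matrix)
    have y: "y $ i = X $ i $ k" for i
      by (simp add: y_def matrix_vector_mult_basis column_def)
    have "x \<bullet> (Y *v x) = x \<bullet> (X *v x) - (x \<bullet> y)\<^sup>2 / X $ k $ k" for x
      by (simp add: Y_def inner_vec_def matrix_vector_mult_def power2_eq_square sum_product
          sum_distrib_left sum_divide_distrib sum_subtractf algebra_simps)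
    \<comment> \<open>Cauchy-Schwarz for the pair \<open>x\<close>, \<open>axis k 1\<close>, where
      the form of \<open>X\<close> at \<open>axis k 1\<close> is \<open>X $ k $ k\<close>.\<close>
    moreover have "(x \<bullet> y)\<^sup>2 / X $ k $ k \<le> x \<bullet> (X *v x)" for x
      using CS[of x "axis k 1"] k by (simp add: y_def inner_axis_matrix divide_le_eq)
    ultimately have "psd_sym Y"
      by (auto simp: psd_sym_def Y_def transpose_def vec_eq_iff sym mult.commute)
    \<comment> \<open>A vanishing diagonal entry of \<open>X\<close> has a vanishing row, so
      \<open>y\<close> is zero there and the entry stays zero in \<open>Y\<close>.\<close>
    moreover have "{i. Y $ i $ i \<noteq> 0} \<subseteq> {i. X $ i $ i \<noteq> 0}"
      using zero by (auto simp: Y_def y)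
    then have "{i. Y $ i $ i \<noteq> 0} \<subset> {i. X $ i $ i \<noteq> 0}"
    proof (rule psubsetI)
      have "Y $ k $ k = 0"
        by (simp add: Y_def y)
      with k show "{i. Y $ i $ i \<noteq> 0} \<noteq> {i. X $ i $ i \<noteq> 0}"
        by force
    qed
    then have "card {i. Y $ i $ i \<noteq> 0} < card {i. X $ i $ i \<noteq> 0}"
      by (intro psubset_card_mono) auto
    ultimately have "0 \<le> trace (A ** Y)"
      using less.hyps by blast
    moreover have "trace (A ** X) = trace (A ** Y) + (y \<bullet> (A *v y)) / X $ k $ k"
      by (simp add: trace_mult_eq_sum Y_def inner_vec_def matrix_vector_mult_def sum_distrib_left
          sum_divide_distrib sum_subtractf algebra_simps)
    ultimately show ?thesis
      using A[of y] k by simp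
  qed
qed

text \<open>Let \<open>r\<close> be the maximum of the form of \<open>A\<close> on the unit sphere,
  attained at \<open>v\<close> by compactness. Then \<open>r *\<^sub>R mat 1 - A\<close> has a
  nonnegative form, and so has its product with \<open>X\<close> a nonnegative trace.\<close>

lemma Rayleigh_quotient_ge_trace:
  fixes A X :: "real^'n^'n"
  assumes X: "psd_sym X"
  obtains v where "norm v = 1" and "trace (A ** X) \<le> (v \<bullet> (A *v v)) * trace X"
proof -
  have "continuous_on (sphere 0 1) (\<lambda>v. v \<bullet> (A *v v))"
    by (intro continuous_on_inner continuous_on_id linear_continuous_on matrix_vector_mul_bounded_linear)
  moreover have "sphere 0 1 \<noteq> ({} :: (real^'n) set)"
    by simp
  ultimately have "\<exists>v\<in>sphere 0 1. \<forall>u\<in>sphere 0 1. u \<bullet> (A *v u) \<le> v \<bullet> (A *v v)"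
    by (intro continuous_attains_sup compact_sphere)
  then obtain v where v: "norm v = 1"
    and max: "\<And>u. norm u = 1 \<Longrightarrow> u \<bullet> (A *v u) \<le> v \<bullet> (A *v v)"
    by auto
  define r where "r = v \<bullet> (A *v v)"
  have "0 \<le> u \<bullet> ((r *\<^sub>R mat 1 - A) *v u)" for u
  proof (cases "u = 0")
    case False
    have "(u /\<^sub>R norm u) \<bullet> (A *v (u /\<^sub>R norm u)) \<le> r"
      unfolding r_def using False by (intro max) simp
    then have "u \<bullet> (A *v u) \<le> r * (norm u)\<^sup>2"
      using False by (simp add: matrix_vector_mult_scaleR field_simps power2_eq_square)
    then show ?thesis
      by (simp add: matrix_vector_mult_diff_rdistrib scaleR_matrix_vector_assoc[symmetric]
          inner_diff_right power2_norm_eq_inner)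
  qed simp
  from trace_mult_psd_nonneg[OF this X] have "0 \<le> trace ((r *\<^sub>R mat 1 - A) ** X)" .
  also have "\<dots> = r * trace (mat 1 ** X) - trace (A ** X)"
    unfolding trace_mult_eq_sum
    by (simp add: left_diff_distrib sum_subtractf sum_distrib_left mult.assoc)
  finally have "trace (A ** X) \<le> r * trace X"
    by simp
  with v show ?thesis
    by (auto simp: r_def intro: that)
qed

text \<open>The direction \<open>u\<close> is \<open>A *v v\<close> normalized. Cauchy-Schwarz for
  the form of \<open>A\<close> suffices, so \<open>v\<close> need not be known to be an
  eigenvector.\<close>

lemma psd_sym_dominates_rank_one:
  assumes A: "psd_sym A" and v: "norm v = 1" and pos: "0 < v \<bullet> (A *v v)"
  obtains u where "norm u = 1" and "\<And>x. (v \<bullet> (A *v v)) * (x \<bullet> u)\<^sup>2 \<le> x \<bullet> (A *v x)"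
proof
  define a where "a = norm (A *v v)"
  have le: "v \<bullet> (A *v v) \<le> a"
    using norm_cauchy_schwarz[of v "A *v v"] v by (simp add: a_def)
  with pos have "0 < a"
    by simp
  then show "norm ((A *v v) /\<^sub>R a) = 1"
    by (simp add: a_def)
  fix x
  let ?r = "v \<bullet> (A *v v)" and ?b = "x \<bullet> (A *v v)"
  \<comment> \<open>The additional factor \<open>?r\<close> matches the one that Cauchy-Schwarz
    brings in next, and is then cancelled.\<close>
  have "?r * (?r * ?b\<^sup>2) \<le> a * (a * ?b\<^sup>2)"
    using le pos by (intro mult_mono) auto
  also have "\<dots> \<le> a * (a * ((x \<bullet> (A *v x)) * ?r))"
    using \<open>0 < a\<close> by (intro mult_left_mono psd_sym_Cauchy_Schwarz[OF A]) auto
  finally have "?r * ?b\<^sup>2 \<le> a * (a * (x \<bullet> (A *v x)))"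
    using pos by (simp add: mult.commute mult.left_commute)
  then show "?r * (x \<bullet> ((A *v v) /\<^sub>R a))\<^sup>2 \<le> x \<bullet> (A *v x)"
    using \<open>0 < a\<close> by (simp add: field_simps power2_eq_square)
qed

section \<open>Rounding a feasible point of the relaxation\<close>

text \<open>The threshold \<theta> solves \<open>(Q - 1) + (n - Q + 1) * \<theta> = Q\<close> with
  \<open>n = card I\<close>. If at most \<open>Q - 1\<close> weights reached it, then, each weight
  being at most 1, the total would stay strictly below \<open>Q\<close>.\<close>

lemma obtain_large_weights:
  fixes \<beta> :: "'i \<Rightarrow> real"
  assumes I: "finite I" and Q: "Q \<le> card I" and sum: "sum \<beta> I = real Q"
    and le1: "\<And>i. i \<in> I \<Longrightarrow> \<beta> i \<le> 1"
  obtains A where "A \<subseteq> I" and "card A = Q"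
    and "\<And>i. i \<in> A \<Longrightarrow> 1 / (real (card I) - real Q + 1) \<le> \<beta> i"
proof -
  define \<theta> where "\<theta> = 1 / (real (card I) - real Q + 1)"
  have \<theta>: "\<theta> * (real (card I) - real Q + 1) = 1" "\<theta> \<le> 1"
    using Q by (auto simp: \<theta>_def)
  define B where "B = {i \<in> I. \<theta> \<le> \<beta> i}"
  have B: "B \<subseteq> I" "finite B"
    using I by (auto simp: B_def)
  have "Q \<le> card B"
  proof (rule ccontr)
    assume "\<not> Q \<le> card B"
    then have cB: "real (card B) \<le> real Q - 1" "card B < card I"
      using Q by auto
    \<comment> \<open>Nonemptiness makes the next bound strict, on which the contradiction
      rests.\<close>
    have "I - B \<noteq> {}"
      using cB(2) B by (metis Diff_eq_empty_iff card_mono leD)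
    then have "sum \<beta> (I - B) < (\<Sum>i\<in>I - B. \<theta>)"
      using I by (intro sum_strict_mono) (auto simp: B_def)
    also have "\<dots> = (real (card I) - real (card B)) * \<theta>"
      using B I by (simp add: card_Diff_subset card_mono of_nat_diff)
    finally have "sum \<beta> (I - B) < (real (card I) - real (card B)) * \<theta>" .
    moreover have "sum \<beta> B \<le> (\<Sum>i\<in>B. 1)"
      using B le1 by (intro sum_mono) auto
    moreover have "sum \<beta> I = sum \<beta> (I - B) + sum \<beta> B"
      using B I by (rule_tac sum.subset_diff)
    ultimately have "real Q < (real (card I) - real (card B)) * \<theta> + real (card B)"
      using sum by simp
    also have "\<dots> = real (card I) * \<theta> + real (card B) * (1 - \<theta>)"
      by (simp add: algebra_simps)
    also have "\<dots> \<le> real (card I) * \<theta> + (real Q - 1) * (1 - \<theta>)"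
      using cB \<theta> by (intro add_left_mono mult_right_mono) auto
    also have "\<dots> = real Q"
      using \<theta>(1) by (simp add: algebra_simps)
    finally show False
      by simp
  qed
  then obtain A where "A \<subseteq> B" "card A = Q"
    using obtain_subset_with_card_n by metis
  then show ?thesis
    using B by (intro that[of A]) (auto simp: B_def \<theta>_def)
qed

text \<open>The vector \<open>x\<close>, together with the indicator of \<open>A\<close>, is
  feasible for (P1), and its squared norm is bounded by a multiple of the (SDP2) objective at
  \<open>X\<close>.\<close>

lemma SDP2_rounding:
  fixes H :: "nat \<Rightarrow> real^'n^'n"
  assumes "Q < M" and \<epsilon>: "0 < \<epsilon>" "\<epsilon> < 1"
    and H: "\<And>i. i \<in> {1..M} \<Longrightarrow> psd_sym (H i)" and X: "psd_sym X"
    and tr: "\<And>i. i \<in> {1..M} \<Longrightarrow> \<beta> i + (1 - \<beta> i) * \<epsilon> \<le> trace (H i ** X)"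
    and sum: "(\<Sum>i\<in>{1..M}. \<beta> i) = real Q"
    and \<beta>: "\<And>i. i \<in> {1..M} \<Longrightarrow> 0 \<le> \<beta> i \<and> \<beta> i \<le> 1"
  obtains A x where "A \<subseteq> {1..M}" and "card A = Q"
    and "\<And>i. i \<in> A \<Longrightarrow> 1 \<le> x \<bullet> (H i *v x)"
    and "\<And>i. i \<in> {1..M} - A \<Longrightarrow> \<epsilon> \<le> x \<bullet> (H i *v x)"
    and "(norm x)\<^sup>2 \<le> (real M - real Q + sqrt (1 / c_eps M Q \<epsilon>) * real Q)\<^sup>2 * trace X"
    and "0 \<le> trace X"
proof -
  obtain A where A: "A \<subseteq> {1..M}" "card A = Q"
    and large: "\<And>i. i \<in> A \<Longrightarrow> 1 / (real M - real Q + 1) \<le> \<beta> i"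
    using obtain_large_weights[of "{1..M}" Q \<beta>] sum \<beta> \<open>Q < M\<close> by auto
  define c where "c = c_eps M Q \<epsilon>"
  define t where "t = trace X"
  define b where "b i = (if i \<in> A then c else \<epsilon>)" for i
  have c: "0 < c"
    using \<epsilon> \<open>Q < M\<close> by (auto simp: c_def c_eps_def intro!: add_pos_nonneg)
  have b: "0 < b i" for i
    using c \<epsilon> by (simp add: b_def)
  have tr_b: "b i \<le> trace (H i ** X)" if i: "i \<in> {1..M}" for i
  proof -
    \<comment> \<open>The right-hand side of the constraint is affine and increasing in
      \<open>\<beta> i\<close>; \<open>c\<close> is its value at the threshold.\<close>
    have "b i \<le> \<epsilon> + (1 - \<epsilon>) * \<beta> i"
      using mult_left_mono[OF large, of i "1 - \<epsilon>"] \<beta>[OF i] \<epsilon>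
      by (simp add: b_def c_def c_eps_def)
    then show ?thesis
      using tr[OF i] by (simp add: algebra_simps)
  qed
  have "0 \<le> axis i 1 \<bullet> (X *v axis i 1)" for i
    using X by (simp add: psd_sym_def)
  then have t0: "0 \<le> t"
    by (auto simp: t_def trace_def inner_axis_matrix intro!: sum_nonneg)
  \<comment> \<open>The claim \<open>0 < t\<close> is included because it comes from an index: with
    \<open>t = 0\<close> the trace bound by \<open>b i > 0\<close> would fail.\<close>
  have "\<exists>u. norm u = 1 \<and> 0 < t \<and> (\<forall>x. b i / t * (x \<bullet> u)\<^sup>2 \<le> x \<bullet> (H i *v x))"
    if i: "i \<in> {1..M}" for i
  proof -
    obtain v where v: "norm v = 1" "trace (H i ** X) \<le> (v \<bullet> (H i *v v)) * t"
      using Rayleigh_quotient_ge_trace[OF X] unfolding t_def by blast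
    with tr_b[OF i] have le: "b i \<le> (v \<bullet> (H i *v v)) * t"
      by simp
    with b[of i] t0 have pos: "0 < v \<bullet> (H i *v v)" "0 < t"
      by (smt (verit) mult_nonneg_nonpos2 mult_nonneg_nonpos mult_eq_0_iff)+
    obtain u where u: "norm u = 1" "\<And>x. (v \<bullet> (H i *v v)) * (x \<bullet> u)\<^sup>2 \<le> x \<bullet> (H i *v x)"
      using psd_sym_dominates_rank_one[OF H[OF i] v(1) pos(1)] by blast
    have "b i / t \<le> v \<bullet> (H i *v v)"
      using le pos by (simp add: divide_le_eq)
    then have "b i / t * (x \<bullet> u)\<^sup>2 \<le> x \<bullet> (H i *v x)" for x
      using u(2)[of x] mult_right_mono[of "b i / t" "v \<bullet> (H i *v v)" "(x \<bullet> u)\<^sup>2"] by simp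
    with u pos show ?thesis
      by blast
  qed
  then obtain u where u: "\<And>i. i \<in> {1..M} \<Longrightarrow> norm (u i) = 1" "\<And>i. i \<in> {1..M} \<Longrightarrow> 0 < t"
    "\<And>i x. i \<in> {1..M} \<Longrightarrow> b i / t * (x \<bullet> u i)\<^sup>2 \<le> x \<bullet> (H i *v x)"
    by metis
  have t: "0 < t"
    using u(2)[of M] \<open>Q < M\<close> by simp
  \<comment> \<open>The widths make \<open>b i / t * (w i)\<^sup>2\<close> equal to 1 on
    \<open>A\<close> and to \<epsilon> elsewhere, just what (P1) demands.\<close>
  define w where "w i = (if i \<in> A then sqrt (t / c) else sqrt t)" for i
  have w: "0 < w i" for i
    using t c by (simp add: w_def)
  obtain x where x: "norm x \<le> (\<Sum>i\<in>{1..M}. w i)" "\<And>i. i \<in> {1..M} \<Longrightarrow> w i \<le> \<bar>x \<bullet> u i\<bar>"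
    using bang[of "{1..M}" u w] u(1) w by blast
  have large_x: "b i / t * (w i)\<^sup>2 \<le> x \<bullet> (H i *v x)" if i: "i \<in> {1..M}" for i
  proof -
    have "(w i)\<^sup>2 \<le> (x \<bullet> u i)\<^sup>2"
      using x(2)[OF i] t c by (simp add: abs_le_square_iff[symmetric] w_def)
    then have "b i / t * (w i)\<^sup>2 \<le> b i / t * (x \<bullet> u i)\<^sup>2"
      using b[of i] t by (intro mult_left_mono) auto
    then show ?thesis
      using u(3)[OF i, of x] by simp
  qed
  have "(\<Sum>i\<in>{1..M}. w i) = (\<Sum>i\<in>{1..M} - A. w i) + (\<Sum>i\<in>A. w i)"
    using A by (intro sum.subset_diff) auto
  also have "(\<Sum>i\<in>{1..M} - A. w i) = real (card ({1..M} - A)) * sqrt t"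
    by (simp add: w_def)
  also have "card ({1..M} - A) = M - Q"
    using A by (simp add: card_Diff_subset finite_subset[OF A(1)])
  also have "(\<Sum>i\<in>A. w i) = real Q * sqrt (t / c)"
    using A by (simp add: w_def)
  finally have "(\<Sum>i\<in>{1..M}. w i) = (real M - real Q + sqrt (1 / c) * real Q) * sqrt t"
    using \<open>Q < M\<close> by (simp add: of_nat_diff real_sqrt_divide algebra_simps)
  with x(1) have "(norm x)\<^sup>2 \<le> ((real M - real Q + sqrt (1 / c) * real Q) * sqrt t)\<^sup>2"
    by (simp add: power_mono)
  then have "(norm x)\<^sup>2 \<le> (real M - real Q + sqrt (1 / c) * real Q)\<^sup>2 * t"
    using t by (simp add: power_mult_distrib)
  moreover have "1 \<le> x \<bullet> (H i *v x)" if "i \<in> A" for i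
    using large_x[of i] that A t c by (auto simp: b_def w_def)
  moreover have "\<epsilon> \<le> x \<bullet> (H i *v x)" if "i \<in> {1..M} - A" for i
    using large_x[of i] that t by (auto simp: b_def w_def)
  ultimately show ?thesis
    using A t that[of A x] unfolding t_def c_def by simp
qed

section \<open>Comparison of the optimal values\<close>

theorem theorem2p5:
  fixes H :: "nat \<Rightarrow> real^'n^'n" and M Q :: nat and \<epsilon> :: real
  assumes "CARD('n) \<ge> 2" and "M \<ge> 2" and "1 \<le> Q" and "Q \<le> M - 1"
    and "0 < \<epsilon>" and "\<epsilon> < 1"
    and "\<forall>i\<in>{1..M}. psd_sym (H i)"
  shows "v_QP M Q \<epsilon> H \<le> ereal (mu_R M Q \<epsilon>) * v_SDP2 M Q \<epsilon> H"
proof -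
  define K where "K = real M - real Q + sqrt (1 / c_eps M Q \<epsilon>) * real Q"
  have QM: "Q < M"
    using assms by auto
  have "0 \<le> c_eps M Q \<epsilon>"
    using assms QM by (simp add: c_eps_def)
  then have "0 < K"
    using QM by (simp add: K_def add_pos_nonneg)
  \<comment> \<open>As \<open>pi < 27\<close>, the first argument of the maximum in
    \<open>mu_R\<close> is at least \<open>K\<^sup>2\<close>.\<close>
  have "K\<^sup>2 \<le> 27 * K\<^sup>2 / pi"
    using mult_right_mono[of pi 27 "K\<^sup>2"] pi_less_4 by (simp add: pos_le_divide_eq mult.commute)
  then have mu: "K\<^sup>2 \<le> mu_R M Q \<epsilon>"
    by (simp add: mu_R_def K_def)
  with \<open>0 < K\<close> have mu_pos: "0 < mu_R M Q \<epsilon>"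
    by (smt (verit) zero_less_power)
  \<comment> \<open>The objective values of (SDP2) are collected in a predicate, the shape in which
    \<open>ereal_Inf_cmult\<close> is applied below.\<close>
  define feas where "feas = (\<lambda>r. \<exists>X \<beta>. r = ereal (trace X) \<and> psd_sym X \<and>
      (\<forall>i\<in>{1..M}. trace (H i ** X) \<ge> \<beta> i + (1 - \<beta> i) * \<epsilon>) \<and>
      (\<Sum>i\<in>{1..M}. \<beta> i) = real Q \<and> (\<forall>i\<in>{1..M}. 0 \<le> \<beta> i \<and> \<beta> i \<le> 1))"
  have "v_QP M Q \<epsilon> H \<le> ereal (mu_R M Q \<epsilon>) * r" if "feas r" for r
  proof -
    from that obtain X \<beta> where r: "r = ereal (trace X)" and X: "psd_sym X"
      and tr: "\<And>i. i \<in> {1..M} \<Longrightarrow> \<beta> i + (1 - \<beta> i) * \<epsilon> \<le> trace (H i ** X)"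
      and sum: "(\<Sum>i\<in>{1..M}. \<beta> i) = real Q"
      and \<beta>: "\<And>i. i \<in> {1..M} \<Longrightarrow> 0 \<le> \<beta> i \<and> \<beta> i \<le> 1"
      unfolding feas_def by blast
    obtain A x where A: "A \<subseteq> {1..M}" "card A = Q"
      and x: "\<And>i. i \<in> A \<Longrightarrow> 1 \<le> x \<bullet> (H i *v x)"
        "\<And>i. i \<in> {1..M} - A \<Longrightarrow> \<epsilon> \<le> x \<bullet> (H i *v x)"
      and nx: "(norm x)\<^sup>2 \<le> K\<^sup>2 * trace X" "0 \<le> trace X"
      using SDP2_rounding[OF QM \<open>0 < \<epsilon>\<close> \<open>\<epsilon> < 1\<close> _ X tr sum \<beta>] assms(7) unfolding K_def by metis
    define \<gamma> :: "nat \<Rightarrow> real" where "\<gamma> i = (if i \<in> A then 1 else 0)" for i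
    have "(\<Sum>i\<in>{1..M}. \<gamma> i) = real Q"
      using A by (simp add: \<gamma>_def sum.If_cases Int_absorb1)
    moreover have "\<forall>i\<in>{1..M}. \<gamma> i \<in> {0, 1}"
      by (simp add: \<gamma>_def)
    moreover have "\<forall>i\<in>{1..M}. \<gamma> i + (1 - \<gamma> i) * \<epsilon> \<le> x \<bullet> (H i *v x)"
      using x by (simp add: \<gamma>_def)
    ultimately have "v_QP M Q \<epsilon> H \<le> ereal ((norm x)\<^sup>2)"
      unfolding v_QP_def by (intro Inf_lower) blast
    also have "(norm x)\<^sup>2 \<le> mu_R M Q \<epsilon> * trace X"
      using nx mult_right_mono[OF mu nx(2)] by simp
    finally show ?thesis
      by (simp add: r)
  qed
  then have "v_QP M Q \<epsilon> H \<le> Inf {ereal (mu_R M Q \<epsilon>) * r |r. feas r}"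
    by (auto intro: Inf_greatest)
  \<comment> \<open>A positive real factor commutes with the infimum also when (SDP2) is infeasible:
    both sides are then infinite.\<close>
  also have "\<dots> = ereal (mu_R M Q \<epsilon>) * Inf {r. feas r}"
    using mu_pos by (rule ereal_Inf_cmult)
  also have "Inf {r. feas r} = v_SDP2 M Q \<epsilon> H"
    by (simp add: v_SDP2_def feas_def)
  finally show ?thesis .
qed

end
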